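(* For any nominal transition system $\mathbf T$, every formula $A$ over $\mathbf T$ and every state $P$: $P\models_{\mathbf T}A$ iff $P\models_{\mathcal S(\mathbf T)}\mathcal S(A)$.
   Context: Nominal sets over a countably infinite (possibly sorted) set of names $\mathcal N$: permutations fix all but finitely many names; every element has finite support $\operatorname{supp}$; $a\# X$ means $a\notin\operatorname{supp}(X)$; $[\mathcal P_{\mathrm{fin}}(\mathcal N)]S$ is $\mathcal P_{\mathrm{fin}}(\mathcal N)\times S$ modulo $(N,X)=_\alpha(N',X')$ iff some $\pi$ with $\pi\cdot(N,X)=(N',X')$ fixes every name of $\operatorname{supp}(X)\setminus N$; classes $\langle N\rangle X$. A nominal transition system: nominal sets STATES, PRED, ACT; equivariant $\vdash\subseteq\mathrm{STATES}\times\mathrm{PRED}$; equivariant $\operatorname{bn}$, $\operatorname{bn}(\alpha)$ a finite subset of $\operatorname{supp}(\alpha)$; equivariant $\rightarrow\ \subseteq\mathrm{STATES}\times[\mathcal P_{\mathrm{fin}}(\mathcal N)](\mathrm{ACT}\times\mathrm{STATES})$ with $(P,\langle N\rangle(\alpha,Q))\in\rightarrow$ only if $N=\operatorname{bn}(\alpha)$; $P\xrightarrow{\alpha}P'$ means $(P,\langle\operatorname{bn}(\alpha)\rangle(\alpha,P'))\in\rightarrow$. Formulas over a nominal transition system: fix an infinite cardinal $\kappa>\aleph_0$ with $\kappa>|\mathrm{STATES}|$; formulas are $\bigwedge_{i\in I}A_i$ (with $\{A_i\}$ of cardinality $<\kappa$ and finitely supported), $\neg A$, $\varphi\in\mathrm{PRED}$,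 $\langle\alpha\rangle A$ with $\operatorname{bn}(\alpha)$ bound in $\alpha$ and $A$. $P\models\bigwedge A_i$ iff all $P\models A_i$; $P\models\neg A$ iff not $P\models A$; $P\models\varphi$ iff $P\vdash\varphi$; $P\models\langle\alpha\rangle A$ iff for a representative with $\operatorname{bn}(\alpha)\# P$ some $P'$ has $P\xrightarrow{\alpha}P'$ and $P'\models A$. $\top$ is the empty conjunction. $\mathcal S(\mathbf T)$ is the nominal transition system with: same states as $\mathbf T$; actions $\mathrm{ACT}_{\mathbf T}\uplus\mathrm{PRED}_{\mathbf T}$; $\operatorname{bn}$ as in $\mathbf T$ on $\mathrm{ACT}_{\mathbf T}$ and $\operatorname{bn}(\varphi)=\emptyset$ for $\varphi\in\mathrm{PRED}_{\mathbf T}$; no state predicates hold; transitions $P\xrightarrow{\alpha}P'$ iff $P\xrightarrow{\alpha}P'$ in $\mathbf T$ (for $\alpha\in\mathrm{ACT}_{\mathbf T}$), and $P\xrightarrow{\varphi}P$ iff $P\vdash_{\mathbf T}\varphi$, with no other $\varphi$-transitions. The translation $\mathcal S$ from formulas over $\mathbf T$ to formulas over $\mathcal S(\mathbf T)$ is defined by $\mathcal S(\varphi)=\langle\varphi\rangle\top$, and homomorphically otherwise: $\mathcal S(\bigwedge A_i)=\bigwedge\mathcal S(A_i)$, $\mathcal S(\neg A)=\neg\mathcal S(A)$, $\mathcal S(\langle\alpha\rangle A)=\langle\alpha\rangle\mathcal S(A)$. *)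

theory Defs
  imports "HOL-Library.Countable_Set_Type"
begin

unbundle cardinal_syntax

section \<open>Nominal sets\<close>

text \<open>
  Names are the elements of a type, and \<open>srt\<close> assigns to every name its sort; the unsorted case is
  that of a constant \<open>srt\<close>.  As usual for sorted names, every inhabited sort is infinite.
\<close>

definition name_sorting :: "('n \<Rightarrow> 's) \<Rightarrow> bool" where
  "name_sorting srt \<longleftrightarrow>
     countable (UNIV :: 'n set) \<and> infinite (UNIV :: 'n set) \<and> (\<forall>a. infinite {b. srt b = srt a})"

definition perms :: "('n \<Rightarrow> 's) \<Rightarrow> ('n \<Rightarrow> 'n) set" where
  "perms srt = {\<pi>. bij \<pi> \<and> finite {a. \<pi> a \<noteq> a} \<and> (\<forall>a. srt (\<pi> a) = srt a)}"

type_synonym ('n, 'x) action = "('n \<Rightarrow> 'n) \<Rightarrow> 'x \<Rightarrow> 'x"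

definition supports :: "('n \<Rightarrow> 's) \<Rightarrow> ('n, 'x) action \<Rightarrow> 'n set \<Rightarrow> 'x \<Rightarrow> bool" where
  "supports srt act N x \<longleftrightarrow> (\<forall>\<pi>\<in>perms srt. (\<forall>a\<in>N. \<pi> a = a) \<longrightarrow> act \<pi> x = x)"

definition finitely_supported :: "('n \<Rightarrow> 's) \<Rightarrow> ('n, 'x) action \<Rightarrow> 'x \<Rightarrow> bool" where
  "finitely_supported srt act x \<longleftrightarrow> (\<exists>N. finite N \<and> supports srt act N x)"

definition supp :: "('n \<Rightarrow> 's) \<Rightarrow> ('n, 'x) action \<Rightarrow> 'x \<Rightarrow> 'n set" where
  "supp srt act x = \<Inter>{N. finite N \<and> supports srt act N x}"

definition nominal_set :: "('n \<Rightarrow> 's) \<Rightarrow> ('n, 'x) action \<Rightarrow> 'x set \<Rightarrow> bool" where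
  "nominal_set srt act X \<longleftrightarrow>
     (\<forall>\<pi>\<in>perms srt. \<forall>x\<in>X. act \<pi> x \<in> X) \<and>
     (\<forall>x\<in>X. act id x = x) \<and>
     (\<forall>\<pi>\<in>perms srt. \<forall>\<rho>\<in>perms srt. \<forall>x\<in>X. act \<pi> (act \<rho> x) = act (\<pi> \<circ> \<rho>) x) \<and>
     (\<forall>x\<in>X. finitely_supported srt act x)"

definition name_set_act :: "('n, 'n set) action" where
  "name_set_act \<pi> N = \<pi> ` N"

definition set_act :: "('n, 'x) action \<Rightarrow> ('n, 'x set) action" where
  "set_act act \<pi> X = act \<pi> ` X"

definition prod_act :: "('n, 'x) action \<Rightarrow> ('n, 'y) action \<Rightarrow> ('n, 'x \<times> 'y) action" where
  "prod_act act act' \<pi> = map_prod (act \<pi>) (act' \<pi>)"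

definition sum_act :: "('n, 'x) action \<Rightarrow> ('n, 'y) action \<Rightarrow> ('n, 'x + 'y) action" where
  "sum_act act act' \<pi> = map_sum (act \<pi>) (act' \<pi>)"

definition alpha_eq ::
  "('n \<Rightarrow> 's) \<Rightarrow> ('n, 'x) action \<Rightarrow> 'n set \<times> 'x \<Rightarrow> 'n set \<times> 'x \<Rightarrow> bool" where
  "alpha_eq srt act = (\<lambda>(N, x) (N', x').
     \<exists>\<pi>\<in>perms srt. prod_act name_set_act act \<pi> (N, x) = (N', x') \<and>
       (\<forall>a \<in> supp srt act x - N. \<pi> a = a))"

text \<open>The class \<open>\<langle>N\<rangle>x\<close>.\<close>

definition abstr :: "('n \<Rightarrow> 's) \<Rightarrow> ('n, 'x) action \<Rightarrow> 'n set \<Rightarrow> 'x \<Rightarrow> ('n set \<times> 'x) set" where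
  "abstr srt act N x = {y. alpha_eq srt act (N, x) y}"


section \<open>Nominal transition systems\<close>

record ('n, 'st, 'p, 'a) nts =
  states :: "'st set"
  state_act :: "('n, 'st) action"
  preds :: "'p set"
  pred_act :: "('n, 'p) action"
  acts :: "'a set"
  act_act :: "('n, 'a) action"
  entails :: "('st \<times> 'p) set"
  bn :: "'a \<Rightarrow> 'n set"
  transitions :: "('st \<times> ('n set \<times> 'a \<times> 'st) set) set"

abbreviation residual ::
  "('n \<Rightarrow> 's) \<Rightarrow> ('n, 'st, 'p, 'a) nts \<Rightarrow> 'n set \<Rightarrow> 'a \<Rightarrow> 'st \<Rightarrow> ('n set \<times> 'a \<times> 'st) set" where
  "residual srt T N \<alpha> Q \<equiv> abstr srt (prod_act (act_act T) (state_act T)) N (\<alpha>, Q)"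

definition is_nts :: "('n \<Rightarrow> 's) \<Rightarrow> ('n, 'st, 'p, 'a) nts \<Rightarrow> bool" where
  "is_nts srt T \<longleftrightarrow>
     nominal_set srt (state_act T) (states T) \<and>
     nominal_set srt (pred_act T) (preds T) \<and>
     nominal_set srt (act_act T) (acts T) \<and>
     entails T \<subseteq> states T \<times> preds T \<and>
     (\<forall>\<pi>\<in>perms srt. \<forall>(P, \<phi>)\<in>entails T. (state_act T \<pi> P, pred_act T \<pi> \<phi>) \<in> entails T) \<and>
     (\<forall>\<alpha>\<in>acts T. finite (bn T \<alpha>) \<and> bn T \<alpha> \<subseteq> supp srt (act_act T) \<alpha>) \<and>
     (\<forall>\<pi>\<in>perms srt. \<forall>\<alpha>\<in>acts T. bn T (act_act T \<pi> \<alpha>) = name_set_act \<pi> (bn T \<alpha>)) \<and>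
     transitions T \<subseteq>
       states T \<times> {residual srt T N \<alpha> Q | N \<alpha> Q. finite N \<and> \<alpha> \<in> acts T \<and> Q \<in> states T} \<and>
     (\<forall>\<pi>\<in>perms srt. \<forall>(P, C)\<in>transitions T.
        (state_act T \<pi> P,
         set_act (prod_act name_set_act (prod_act (act_act T) (state_act T))) \<pi> C)
          \<in> transitions T) \<and>
     (\<forall>P\<in>states T. \<forall>\<alpha>\<in>acts T. \<forall>Q\<in>states T. \<forall>N. finite N \<longrightarrow>
        (P, residual srt T N \<alpha> Q) \<in> transitions T \<longrightarrow> N = bn T \<alpha>)"

definition step :: "('n \<Rightarrow> 's) \<Rightarrow> ('n, 'st, 'p, 'a) nts \<Rightarrow> 'st \<Rightarrow> 'a \<Rightarrow> 'st \<Rightarrow> bool" where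
  "step srt T P \<alpha> P' \<longleftrightarrow>
     P \<in> states T \<and> \<alpha> \<in> acts T \<and> P' \<in> states T \<and>
     (P, residual srt T (bn T \<alpha>) \<alpha> P') \<in> transitions T"


section \<open>Formulas\<close>

text \<open>
  Formulas have sets of subformulas below a conjunction and an \<open>\<alpha>\<close>-equivalence class of pairs of an
  action and a formula below a modality, so that \<open>\<alpha>\<close>-equivalent formulas are equal.  The classes
  are countable, as there are only countably many permutations.  A set of at most \<open>|UNIV :: 'k set|\<close>
  trees is represented by one chosen enumeration of it, see \<open>Conj\<close> below; trees with any other
  enumeration, and trees with an argument of \<open>Mod\<close> that is not a class, are not formulas.
\<close>

datatype ('n, 'k, 'p, 'a) tree =
    Fam "'k \<Rightarrow> ('n, 'k, 'p, 'a) tree option"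
  | Neg "('n, 'k, 'p, 'a) tree"
  | Pred 'p
  | Mod "('n set \<times> 'a \<times> ('n, 'k, 'p, 'a) tree) cset"

definition members :: "('k \<Rightarrow> 'x option) \<Rightarrow> 'x set" where
  "members f = {x. \<exists>k. f k = Some x}"

definition Conj :: "('n, 'k, 'p, 'a) tree set \<Rightarrow> ('n, 'k, 'p, 'a) tree" where
  "Conj X = Fam (SOME f. members f = X)"

definition Top :: "('n, 'k, 'p, 'a) tree" where
  "Top = Conj {}"

primrec tree_act :: "('n, 'st, 'p, 'a) nts \<Rightarrow> ('n, ('n, 'k, 'p, 'a) tree) action" where
  "tree_act T \<pi> (Fam f) = Conj (members (map_option (tree_act T \<pi>) \<circ> f))"
| "tree_act T \<pi> (Neg A) = Neg (tree_act T \<pi> A)"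
| "tree_act T \<pi> (Pred \<phi>) = Pred (pred_act T \<pi> \<phi>)"
| "tree_act T \<pi> (Mod C) =
     Mod (cimage (map_prod (name_set_act \<pi>) (map_prod (act_act T \<pi>) (tree_act T \<pi>))) C)"

definition Dia :: "('n \<Rightarrow> 's) \<Rightarrow> ('n, 'st, 'p, 'a) nts \<Rightarrow> 'a \<Rightarrow> ('n, 'k, 'p, 'a) tree
    \<Rightarrow> ('n, 'k, 'p, 'a) tree" where
  "Dia srt T \<alpha> A = Mod (acset (abstr srt (prod_act (act_act T) (tree_act T)) (bn T \<alpha>) (\<alpha>, A)))"

inductive_set formulas ::
  "('n \<Rightarrow> 's) \<Rightarrow> ('n, 'st, 'p, 'a) nts \<Rightarrow> 'k rel \<Rightarrow> ('n, 'k, 'p, 'a) tree set"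
  for srt :: "'n \<Rightarrow> 's" and T :: "('n, 'st, 'p, 'a) nts" and \<kappa> :: "'k rel"
where
  Conj: "\<lbrakk>\<And>A. A \<in> X \<Longrightarrow> A \<in> formulas srt T \<kappa>; |X| <o \<kappa>;
          finitely_supported srt (set_act (tree_act T)) X\<rbrakk> \<Longrightarrow> Conj X \<in> formulas srt T \<kappa>"
| Neg: "A \<in> formulas srt T \<kappa> \<Longrightarrow> Neg A \<in> formulas srt T \<kappa>"
| Pred: "\<phi> \<in> preds T \<Longrightarrow> Pred \<phi> \<in> formulas srt T \<kappa>"
| Dia: "\<alpha> \<in> acts T \<Longrightarrow> A \<in> formulas srt T \<kappa> \<Longrightarrow> Dia srt T \<alpha> A \<in> formulas srt T \<kappa>"

text \<open>
  The argument of \<open>Mod\<close> in a formula is the set of all representatives of the modality, so the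
  clause for \<open>Mod\<close> says that there is a representative whose bound names are fresh for the state
  and which is satisfied; see \<open>satisfies_simps\<close> below.
\<close>

primrec sat :: "('n \<Rightarrow> 's) \<Rightarrow> ('n, 'st, 'p, 'a) nts \<Rightarrow> ('n, 'k, 'p, 'a) tree \<Rightarrow> 'st \<Rightarrow> bool" where
  "sat srt T (Fam f) = (\<lambda>P. \<forall>q \<in> members (map_option (sat srt T) \<circ> f). q P)"
| "sat srt T (Neg A) = (\<lambda>P. \<not> sat srt T A P)"
| "sat srt T (Pred \<phi>) = (\<lambda>P. (P, \<phi>) \<in> entails T)"
| "sat srt T (Mod C) = (\<lambda>P.
     \<exists>(N, \<alpha>, q) \<in> rcset (cimage (map_prod id (map_prod id (sat srt T))) C).
       bn T \<alpha> \<inter> supp srt (state_act T) P = {} \<and> (\<exists>P'. step srt T P \<alpha> P' \<and> q P'))"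

abbreviation satisfies ::
  "('n \<Rightarrow> 's) \<Rightarrow> ('n, 'st, 'p, 'a) nts \<Rightarrow> 'st \<Rightarrow> ('n, 'k, 'p, 'a) tree \<Rightarrow> bool" where
  "satisfies srt T P A \<equiv> sat srt T A P"


section \<open>State predicates as actions\<close>

definition S_nts ::
  "('n \<Rightarrow> 's) \<Rightarrow> ('n, 'st, 'p, 'a) nts \<Rightarrow> ('n, 'st, 'p, 'a + 'p) nts" where
  "S_nts srt T =
    \<lparr>states = states T, state_act = state_act T,
     preds = preds T, pred_act = pred_act T,
     acts = acts T <+> preds T, act_act = sum_act (act_act T) (pred_act T),
     entails = {},
     bn = case_sum (bn T) (\<lambda>_. {}),
     transitions =
       {(P, abstr srt (prod_act (sum_act (act_act T) (pred_act T)) (state_act T))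
              (bn T \<alpha>) (Inl \<alpha>, P')) | P \<alpha> P'. step srt T P \<alpha> P'} \<union>
       {(P, abstr srt (prod_act (sum_act (act_act T) (pred_act T)) (state_act T))
              {} (Inr \<phi>, P)) | P \<phi>. (P, \<phi>) \<in> entails T}\<rparr>"

text \<open>
  On a class of representatives the translation acts representative by representative; that this
  gives the class of the translated modality is \<open>S_fm_Dia\<close> below.
\<close>

primrec S_fm :: "('n \<Rightarrow> 's) \<Rightarrow> ('n, 'st, 'p, 'a) nts \<Rightarrow> ('n, 'k, 'p, 'a) tree
    \<Rightarrow> ('n, 'k, 'p, 'a + 'p) tree" where
  "S_fm srt T (Fam f) = Conj (members (map_option (S_fm srt T) \<circ> f))"
| "S_fm srt T (Neg A) = Neg (S_fm srt T A)"
| "S_fm srt T (Pred \<phi>) = Dia srt (S_nts srt T) (Inr \<phi>) Top"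
| "S_fm srt T (Mod C) = Mod (cimage (map_prod id (map_prod Inl (S_fm srt T))) C)"


section \<open>Basic facts\<close>

subsection \<open>Permutations and support\<close>

lemma perms_id: "id \<in> perms srt"
  by (simp add: perms_def)

lemma perms_comp: "\<pi> \<in> perms srt \<Longrightarrow> \<rho> \<in> perms srt \<Longrightarrow> \<pi> \<circ> \<rho> \<in> perms srt"
proof -
  assume *: "\<pi> \<in> perms srt" "\<rho> \<in> perms srt"
  have "{a. (\<pi> \<circ> \<rho>) a \<noteq> a} \<subseteq> {a. \<pi> a \<noteq> a} \<union> {a. \<rho> a \<noteq> a}"
    by auto
  moreover have "finite ({a. \<pi> a \<noteq> a} \<union> {a. \<rho> a \<noteq> a})"
    using * by (simp add: perms_def)
  ultimately have "finite {a. (\<pi> \<circ> \<rho>) a \<noteq> a}"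
    using finite_subset by blast
  then show ?thesis
    using * by (auto simp: perms_def intro: bij_comp)
qed

lemma perms_inv: "\<pi> \<in> perms srt \<Longrightarrow> inv \<pi> \<in> perms srt"
proof -
  assume *: "\<pi> \<in> perms srt"
  then have b: "bij \<pi>" by (simp add: perms_def)
  then have eq: "\<pi> (inv \<pi> a) = a" "inv \<pi> (\<pi> a) = a" for a
    by (simp_all add: bij_is_surj surj_f_inv_f bij_is_inj)
  have "inv \<pi> a = a \<longleftrightarrow> \<pi> a = a" for a
    using eq[of a] by auto
  then have "{a. inv \<pi> a \<noteq> a} = {a. \<pi> a \<noteq> a}" by simp
  moreover have "srt (inv \<pi> a) = srt a" for a
  proof -
    have "srt (\<pi> (inv \<pi> a)) = srt (inv \<pi> a)" using * by (simp add: perms_def)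
    then show ?thesis by (simp add: eq)
  qed
  ultimately show ?thesis
    using * b by (simp add: perms_def bij_imp_bij_inv)
qed

lemma perms_inv_o:
  assumes "\<pi> \<in> perms srt" shows "inv \<pi> \<circ> \<pi> = id" "\<pi> \<circ> inv \<pi> = id"
  using assms by (auto simp: perms_def fun_eq_iff bij_is_surj surj_f_inv_f bij_is_inj)

lemma perms_inv_apply:
  assumes "\<pi> \<in> perms srt" shows "inv \<pi> (\<pi> a) = a" "\<pi> (inv \<pi> a) = a"
  using perms_inv_o[OF assms] by (auto simp: fun_eq_iff)

lemma perms_inj: "\<pi> \<in> perms srt \<Longrightarrow> \<pi> a = \<pi> b \<longleftrightarrow> a = b"
  by (metis perms_inv_apply(1))

lemma countable_perms:
  assumes "countable (UNIV :: 'n set)"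
  shows "countable (perms (srt :: 'n \<Rightarrow> 's))"
proof -
  let ?g = "\<lambda>\<pi> :: 'n \<Rightarrow> 'n. (\<lambda>a. (a, \<pi> a)) ` {a. \<pi> a \<noteq> a}"
  have "inj_on ?g (perms srt)"
  proof (rule inj_onI, rule ext)
    fix \<pi> \<rho> :: "'n \<Rightarrow> 'n" and a
    assume eq: "?g \<pi> = ?g \<rho>"
    have "(a, \<pi> a) \<in> ?g \<rho>" if "\<pi> a \<noteq> a"
      unfolding eq[symmetric] using that by blast
    moreover have "(a, \<rho> a) \<in> ?g \<pi>" if "\<rho> a \<noteq> a"
      unfolding eq using that by blast
    ultimately show "\<pi> a = \<rho> a" by (cases "\<pi> a = a"; cases "\<rho> a = a") auto
  qed
  moreover have "?g ` perms srt \<subseteq> {A. finite A \<and> A \<subseteq> UNIV}"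
    by (auto simp: perms_def)
  moreover have "countable {A :: ('n \<times> 'n) set. finite A \<and> A \<subseteq> UNIV}"
    by (rule countable_Collect_finite_subset)
       (use countable_SIGMA[OF assms, of "\<lambda>_. UNIV"] assms in simp)
  ultimately show ?thesis
    by (meson countable_image_inj_on countable_subset)
qed

lemma perms_swap:
  assumes "srt a = srt b"
  shows "id(a := b, b := a) \<in> perms srt"
proof -
  have "bij (id(a := b, b := a))"
    by (rule involuntory_imp_bij) auto
  moreover have "finite {c. (id(a := b, b := a)) c \<noteq> c}"
    by (rule finite_subset[of _ "{a, b}"]) auto
  ultimately show ?thesis using assms by (auto simp: perms_def)
qed

lemma fresh_perm:
  assumes "name_sorting srt" "finite B" "finite N" "finite M" "B \<inter> N = {}"
  shows "\<exists>\<tau>\<in>perms srt. (\<forall>a\<in>N. \<tau> a = a) \<and> \<tau> ` B \<inter> M = {}"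
  using assms(2,5)
proof (induction B)
  case empty
  show ?case by (rule bexI[OF _ perms_id]) auto
next
  case (insert b B)
  then obtain \<tau> where \<tau>: "\<tau> \<in> perms srt" "\<forall>a\<in>N. \<tau> a = a" "\<tau> ` B \<inter> M = {}"
    by auto
  have "infinite {c. srt c = srt b}"
    using assms(1) by (simp add: name_sorting_def)
  moreover have "finite (N \<union> M \<union> \<tau> ` B \<union> {\<tau> b})"
    using assms insert by simp
  ultimately obtain c where c: "srt c = srt b" "c \<notin> N \<union> M \<union> \<tau> ` B \<union> {\<tau> b}"
    by (metis (mono_tags, lifting) finite_subset mem_Collect_eq subsetI)
  let ?s = "id(\<tau> b := c, c := \<tau> b)"
  have "srt (\<tau> b) = srt c"
    using \<tau>(1) c(1) by (simp add: perms_def)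
  then have "?s \<circ> \<tau> \<in> perms srt"
    using perms_comp[OF perms_swap \<tau>(1)] by blast
  moreover have "(?s \<circ> \<tau>) a = a" if "a \<in> N" for a
  proof -
    have "\<tau> b \<noteq> a" using \<tau>(2) that insert.prems perms_inj[OF \<tau>(1), of b a] by auto
    then show ?thesis using that \<tau>(2) c(2) by auto
  qed
  moreover have "(?s \<circ> \<tau>) x \<notin> M" if "x \<in> insert b B" for x
  proof (cases "x = b")
    case True
    then show ?thesis using c(2) by auto
  next
    case False
    then have "x \<in> B" "\<tau> x \<noteq> \<tau> b" using that perms_inj[OF \<tau>(1)] by auto
    then show ?thesis using c(2) \<tau>(3) by auto
  qed
  ultimately show ?case by blast
qed

definition acts_on :: "('n \<Rightarrow> 's) \<Rightarrow> ('n, 'x) action \<Rightarrow> 'x \<Rightarrow> bool" where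
  "acts_on srt act x \<longleftrightarrow>
     act id x = x \<and> (\<forall>\<pi>\<in>perms srt. \<forall>\<rho>\<in>perms srt. act \<pi> (act \<rho> x) = act (\<pi> \<circ> \<rho>) x)"

lemma acts_on_id: "acts_on srt act x \<Longrightarrow> act id x = x"
  by (simp add: acts_on_def)

lemma acts_on_comp:
  "acts_on srt act x \<Longrightarrow> \<pi> \<in> perms srt \<Longrightarrow> \<rho> \<in> perms srt \<Longrightarrow> act \<pi> (act \<rho> x) = act (\<pi> \<circ> \<rho>) x"
  by (simp add: acts_on_def)

lemma acts_on_act: "acts_on srt act x \<Longrightarrow> \<pi> \<in> perms srt \<Longrightarrow> acts_on srt act (act \<pi> x)"
  unfolding acts_on_def by (simp add: perms_comp perms_id comp_assoc)

lemma acts_on_inv: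
  assumes "acts_on srt act x" "\<pi> \<in> perms srt"
  shows "act (inv \<pi>) (act \<pi> x) = x"
  using acts_on_comp[OF assms(1) perms_inv[OF assms(2)] assms(2)] acts_on_id[OF assms(1)]
  by (simp add: perms_inv_o(1)[OF assms(2)])

lemma acts_on_prod:
  "acts_on srt f x \<Longrightarrow> acts_on srt g y \<Longrightarrow> acts_on srt (prod_act f g) (x, y)"
  by (simp add: acts_on_def prod_act_def)

lemma acts_on_name_set: "acts_on srt name_set_act N"
  by (simp add: acts_on_def name_set_act_def image_comp)

lemma acts_on_set: "(\<And>x. x \<in> X \<Longrightarrow> acts_on srt act x) \<Longrightarrow> acts_on srt (set_act act) X"
  by (simp add: acts_on_def set_act_def image_image)

lemma nominal_acts_on: "nominal_set srt act X \<Longrightarrow> x \<in> X \<Longrightarrow> acts_on srt act x"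
  by (simp add: nominal_set_def acts_on_def)

lemma nominal_fs: "nominal_set srt act X \<Longrightarrow> x \<in> X \<Longrightarrow> finitely_supported srt act x"
  by (simp add: nominal_set_def)

lemma nominal_act: "nominal_set srt act X \<Longrightarrow> x \<in> X \<Longrightarrow> \<pi> \<in> perms srt \<Longrightarrow> act \<pi> x \<in> X"
  by (simp add: nominal_set_def)

lemma supports_act:
  assumes "acts_on srt act x" "\<pi> \<in> perms srt" "supports srt act N x"
  shows "supports srt act (\<pi> ` N) (act \<pi> x)"
  unfolding supports_def
proof (intro ballI impI)
  fix \<rho> assume \<rho>: "\<rho> \<in> perms srt" "\<forall>a\<in>\<pi> ` N. \<rho> a = a"
  have "inv \<pi> \<circ> \<rho> \<circ> \<pi> \<in> perms srt"
    by (intro perms_comp perms_inv assms \<rho>)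
  moreover have "\<forall>a\<in>N. (inv \<pi> \<circ> \<rho> \<circ> \<pi>) a = a"
    using \<rho>(2) perms_inv_apply[OF assms(2)] by simp
  ultimately have "act (inv \<pi> \<circ> \<rho> \<circ> \<pi>) x = x"
    using assms(3) by (simp add: supports_def)
  then have "act \<pi> x = act (\<pi> \<circ> (inv \<pi> \<circ> \<rho> \<circ> \<pi>)) x"
    using acts_on_comp[OF assms(1,2) \<open>inv \<pi> \<circ> \<rho> \<circ> \<pi> \<in> perms srt\<close>] by simp
  also have "\<pi> \<circ> (inv \<pi> \<circ> \<rho> \<circ> \<pi>) = \<rho> \<circ> \<pi>"
    by (simp add: o_assoc perms_inv_o[OF assms(2)])
  also have "act (\<rho> \<circ> \<pi>) x = act \<rho> (act \<pi> x)"
    using acts_on_comp[OF assms(1) \<rho>(1) assms(2)] by simp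
  finally show "act \<rho> (act \<pi> x) = act \<pi> x" by (rule sym)
qed

lemma fs_act:
  "acts_on srt act x \<Longrightarrow> \<pi> \<in> perms srt \<Longrightarrow> finitely_supported srt act x \<Longrightarrow>
   finitely_supported srt act (act \<pi> x)"
  unfolding finitely_supported_def by (blast intro: supports_act)

lemma supp_act:
  assumes "acts_on srt act x" "\<pi> \<in> perms srt"
  shows "supp srt act (act \<pi> x) = \<pi> ` supp srt act x"
proof -
  have "{N. finite N \<and> supports srt act N (act \<pi> x)} =
        (`) \<pi> ` {N. finite N \<and> supports srt act N x}" (is "?L = ?R")
  proof
    show "?L \<subseteq> ?R"
    proof
      fix N assume N: "N \<in> ?L"
      have "supports srt act (inv \<pi> ` N) x"
        using supports_act[OF acts_on_act[OF assms] perms_inv[OF assms(2)], of N] N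
        by (simp add: acts_on_inv[OF assms])
      moreover have "N = \<pi> ` (inv \<pi> ` N)"
        by (simp add: image_comp perms_inv_o[OF assms(2)])
      ultimately show "N \<in> ?R" using N by blast
    qed
    show "?R \<subseteq> ?L" using supports_act[OF assms] by auto
  qed
  then show ?thesis
    unfolding supp_def
    using bij_image_INT[of \<pi> "\<lambda>N. N" "{N. finite N \<and> supports srt act N x}"] assms(2)
    by (simp add: perms_def)
qed

lemma supports_Int:
  assumes "name_sorting srt" "acts_on srt act x"
    and "finite N" "finite M" "supports srt act N x" "supports srt act M x"
  shows "supports srt act (N \<inter> M) x"
  unfolding supports_def
proof (intro ballI impI)
  fix \<pi> assume \<pi>: "\<pi> \<in> perms srt" "\<forall>a\<in>N \<inter> M. \<pi> a = a"
  have "finite {a. \<pi> a \<noteq> a}" "(M - N) \<inter> N = {}" "finite (M - N)"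
    using \<pi>(1) assms(4) by (auto simp: perms_def)
  from fresh_perm[OF assms(1) this(3) assms(3) this(1,2)]
  obtain \<tau> where \<tau>: "\<tau> \<in> perms srt" "\<forall>a\<in>N. \<tau> a = a" "\<tau> ` (M - N) \<inter> {a. \<pi> a \<noteq> a} = {}"
    by (elim bexE conjE)
  have "act \<tau> x = x" using \<tau> assms(5) by (simp add: supports_def)
  then have "supports srt act (\<tau> ` M) x"
    using supports_act[OF assms(2) \<tau>(1) assms(6)] by simp
  moreover have "\<forall>a\<in>\<tau> ` M. \<pi> a = a"
  proof
    fix a assume "a \<in> \<tau> ` M"
    then obtain b where b: "b \<in> M" "a = \<tau> b" by auto
    then show "\<pi> a = a" using \<tau> \<pi> by (cases "b \<in> N") auto
  qed
  ultimately show "act \<pi> x = x" using \<pi>(1) by (simp add: supports_def)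
qed

lemma supp_supports:
  assumes "name_sorting srt" "acts_on srt act x" "finitely_supported srt act x"
  shows "finite (supp srt act x)" "supports srt act (supp srt act x) x"
proof -
  obtain N where N: "finite N" "supports srt act N x"
    using assms(3) by (auto simp: finitely_supported_def)
  then show fin: "finite (supp srt act x)"
    unfolding supp_def by (metis (mono_tags, lifting) Inter_lower finite_subset mem_Collect_eq)
  define M where "M = (ARG_MIN card M. finite M \<and> supports srt act M x)"
  have M: "finite M" "supports srt act M x"
    and least: "\<And>K. finite K \<Longrightarrow> supports srt act K x \<Longrightarrow> card M \<le> card K"
    unfolding M_def using arg_min_natI[of "\<lambda>M. finite M \<and> supports srt act M x" N card]
      arg_min_nat_le[of "\<lambda>M. finite M \<and> supports srt act M x" _ card] N by auto
  have "M \<subseteq> K" if "finite K" "supports srt act K x" for K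
  proof -
    have "card M \<le> card (M \<inter> K)"
      using least[of "M \<inter> K"] supports_Int[OF assms(1,2) M(1) that(1) M(2) that(2)] M(1) by simp
    then have "M \<inter> K = M"
      using M(1) by (metis Int_lower1 card_seteq)
    then show ?thesis by auto
  qed
  then have "supp srt act x = M"
    unfolding supp_def using M by auto
  then show "supports srt act (supp srt act x) x" using M by simp
qed

lemma supp_cong:
  assumes "\<And>\<pi>. \<pi> \<in> perms srt \<Longrightarrow> act' \<pi> y = y \<longleftrightarrow> act \<pi> x = x"
  shows "supp srt act' y = supp srt act x"
  using assms by (simp add: supp_def supports_def)

lemma nominal_prod:
  assumes "nominal_set srt f X" "nominal_set srt g Y"
  shows "nominal_set srt (prod_act f g) (X \<times> Y)"
proof -
  have "finitely_supported srt (prod_act f g) (x, y)" if xy: "x \<in> X" "y \<in> Y" for x y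
  proof -
    obtain N M where "finite N" "supports srt f N x" "finite M" "supports srt g M y"
      using nominal_fs[OF assms(1) xy(1)] nominal_fs[OF assms(2) xy(2)]
      by (auto simp: finitely_supported_def)
    then show ?thesis
      unfolding finitely_supported_def
      by (intro exI[of _ "N \<union> M"]) (auto simp: supports_def prod_act_def)
  qed
  then show ?thesis using assms by (auto simp: nominal_set_def prod_act_def)
qed

lemma nominal_sum:
  assumes "nominal_set srt f X" "nominal_set srt g Y"
  shows "nominal_set srt (sum_act f g) (X <+> Y)"
proof -
  have "finitely_supported srt (sum_act f g) (Inl x)" if "x \<in> X" for x
    using nominal_fs[OF assms(1) that] by (auto simp: finitely_supported_def supports_def sum_act_def)
  moreover have "finitely_supported srt (sum_act f g) (Inr y)" if "y \<in> Y" for y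
    using nominal_fs[OF assms(2) that] by (auto simp: finitely_supported_def supports_def sum_act_def)
  ultimately show ?thesis using assms by (auto simp: nominal_set_def sum_act_def)
qed


subsection \<open>Abstraction\<close>

lemma mem_abstr:
  "(N', x') \<in> abstr srt act N x \<longleftrightarrow>
    (\<exists>\<pi>\<in>perms srt. N' = \<pi> ` N \<and> x' = act \<pi> x \<and> (\<forall>a\<in>supp srt act x - N. \<pi> a = a))"
  by (auto simp: abstr_def alpha_eq_def prod_act_def name_set_act_def)

lemma abstr_self: "acts_on srt act x \<Longrightarrow> (N, x) \<in> abstr srt act N x"
  unfolding mem_abstr by (rule bexI[OF _ perms_id]) (simp add: acts_on_id)

lemma countable_abstr:
  assumes "countable (UNIV :: 'n set)"
  shows "countable (abstr (srt :: 'n \<Rightarrow> 's) act N x)"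
proof -
  have "abstr srt act N x \<subseteq> (\<lambda>\<pi>. (\<pi> ` N, act \<pi> x)) ` perms srt"
    by (auto simp: mem_abstr)
  then show ?thesis
    using countable_perms[OF assms] by (meson countable_image countable_subset)
qed

lemma abstr_subset:
  assumes "acts_on srt act x" "(N', x') \<in> abstr srt act N x"
  shows "abstr srt act N' x' \<subseteq> abstr srt act N x"
proof (rule subrelI)
  fix M y assume "(M, y) \<in> abstr srt act N' x'"
  then obtain \<rho> where \<rho>: "\<rho> \<in> perms srt" "M = \<rho> ` N'" "y = act \<rho> x'"
      "\<forall>a\<in>supp srt act x' - N'. \<rho> a = a"
    by (auto simp: mem_abstr)
  obtain \<pi> where \<pi>: "\<pi> \<in> perms srt" "N' = \<pi> ` N" "x' = act \<pi> x"
      "\<forall>a\<in>supp srt act x - N. \<pi> a = a"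
    using assms(2) by (auto simp: mem_abstr)
  have "(\<rho> \<circ> \<pi>) a = a" if "a \<in> supp srt act x - N" for a
  proof -
    have "a \<in> supp srt act x' - N'"
      using that \<pi> supp_act[OF assms(1) \<pi>(1)] perms_inj[OF \<pi>(1)]
      by (metis (no_types, lifting) DiffD1 DiffD2 DiffI image_iff)
    then show ?thesis using that \<rho>(4) \<pi>(4) by simp
  qed
  moreover have "y = act (\<rho> \<circ> \<pi>) x"
    using \<rho> \<pi> acts_on_comp[OF assms(1) \<rho>(1) \<pi>(1)] by simp
  ultimately show "(M, y) \<in> abstr srt act N x"
    unfolding mem_abstr \<rho>(2) \<pi>(2) image_comp
    using perms_comp[OF \<rho>(1) \<pi>(1)] by blast
qed

lemma abstr_sym:
  assumes "acts_on srt act x" "(N', x') \<in> abstr srt act N x"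
  shows "(N, x) \<in> abstr srt act N' x'"
proof -
  obtain \<pi> where \<pi>: "\<pi> \<in> perms srt" "N' = \<pi> ` N" "x' = act \<pi> x"
      "\<forall>a\<in>supp srt act x - N. \<pi> a = a"
    using assms(2) by (auto simp: mem_abstr)
  have "inv \<pi> a = a" if "a \<in> supp srt act x' - N'" for a
  proof -
    have "a \<in> \<pi> ` (supp srt act x - N)"
      using that unfolding \<pi>(2,3) supp_act[OF assms(1) \<pi>(1)] by blast
    then obtain b where "b \<in> supp srt act x - N" "a = \<pi> b" by blast
    then show ?thesis using \<pi>(4) perms_inv_apply(1)[OF \<pi>(1)] by metis
  qed
  moreover have "N = inv \<pi> ` N'"
    using \<pi>(2) by (simp add: image_comp perms_inv_o[OF \<pi>(1)])
  moreover have "x = act (inv \<pi>) x'"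
    using \<pi>(3) acts_on_inv[OF assms(1) \<pi>(1)] by simp
  ultimately show ?thesis
    using perms_inv[OF \<pi>(1)] by (auto simp: mem_abstr)
qed

lemma abstr_eq:
  assumes "acts_on srt act x" "(N', x') \<in> abstr srt act N x"
  shows "abstr srt act N' x' = abstr srt act N x"
proof -
  have "acts_on srt act x'"
    using assms by (auto simp: mem_abstr intro: acts_on_act)
  then show ?thesis
    using abstr_subset abstr_sym assms by (metis subset_antisym)
qed

lemma act_abstr:
  assumes "acts_on srt act x" "\<pi> \<in> perms srt"
  shows "map_prod (name_set_act \<pi>) (act \<pi>) ` abstr srt act N x = abstr srt act (\<pi> ` N) (act \<pi> x)"
proof -
  have sub: "map_prod (name_set_act \<pi>) (act \<pi>) ` abstr srt act N x \<subseteq> abstr srt act (\<pi> ` N) (act \<pi> x)"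
    if x: "acts_on srt act x" and \<pi>: "\<pi> \<in> perms srt" for x N \<pi>
  proof clarsimp
    fix M y assume "(M, y) \<in> abstr srt act N x"
    then obtain \<rho> where \<rho>: "\<rho> \<in> perms srt" "M = \<rho> ` N" "y = act \<rho> x"
        "\<forall>a\<in>supp srt act x - N. \<rho> a = a"
      by (auto simp: mem_abstr)
    let ?\<sigma> = "\<pi> \<circ> \<rho> \<circ> inv \<pi>"
    have \<sigma>: "?\<sigma> \<in> perms srt" by (intro perms_comp perms_inv \<pi> \<rho>)
    have c: "?\<sigma> \<circ> \<pi> = \<pi> \<circ> \<rho>"
      using perms_inv_apply[OF \<pi>] by (auto simp: fun_eq_iff)
    have "\<pi> ` M = ?\<sigma> ` (\<pi> ` N)"
      unfolding image_comp c \<rho>(2) by simp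
    moreover have "act \<pi> y = act ?\<sigma> (act \<pi> x)"
      using acts_on_comp[OF x \<sigma> \<pi>] acts_on_comp[OF x \<pi> \<rho>(1)] \<rho>(3) by (simp add: c)
    moreover have "\<forall>a\<in>supp srt act (act \<pi> x) - \<pi> ` N. ?\<sigma> a = a"
    proof
      fix a assume "a \<in> supp srt act (act \<pi> x) - \<pi> ` N"
      then obtain b where "b \<in> supp srt act x - N" "a = \<pi> b"
        unfolding supp_act[OF x \<pi>] by blast
      then show "?\<sigma> a = a" using \<rho>(4) perms_inv_apply[OF \<pi>] by simp
    qed
    ultimately show "(name_set_act \<pi> M, act \<pi> y) \<in> abstr srt act (\<pi> ` N) (act \<pi> x)"
      unfolding mem_abstr name_set_act_def using \<sigma> by blast
  qed
  have "abstr srt act (\<pi> ` N) (act \<pi> x) \<subseteq> map_prod (name_set_act \<pi>) (act \<pi>) ` abstr srt act N x"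
  proof (rule subrelI)
    fix M y assume *: "(M, y) \<in> abstr srt act (\<pi> ` N) (act \<pi> x)"
    then have y: "acts_on srt act y"
      using assms by (auto simp: mem_abstr intro: acts_on_act)
    have "map_prod (name_set_act (inv \<pi>)) (act (inv \<pi>)) (M, y) \<in> abstr srt act N x"
      using sub[OF acts_on_act[OF assms] perms_inv[OF assms(2)], of "\<pi> ` N"] *
      by (force simp: acts_on_inv[OF assms] image_comp perms_inv_o[OF assms(2)])
    moreover have "(M, y) = map_prod (name_set_act \<pi>) (act \<pi>) (map_prod (name_set_act (inv \<pi>)) (act (inv \<pi>)) (M, y))"
      using acts_on_comp[OF y assms(2) perms_inv[OF assms(2)]]
      by (simp add: name_set_act_def image_comp perms_inv_o[OF assms(2)] acts_on_id[OF y])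
    ultimately show "(M, y) \<in> map_prod (name_set_act \<pi>) (act \<pi>) ` abstr srt act N x"
      by (metis image_eqI)
  qed
  then show ?thesis using sub[OF assms] by blast
qed

lemma abstr_image:
  assumes "supp srt act' (h x) = supp srt act x"
    and "\<And>\<pi>. \<pi> \<in> perms srt \<Longrightarrow> act' \<pi> (h x) = h (act \<pi> x)"
  shows "abstr srt act' N (h x) = map_prod id h ` abstr srt act N x"
proof (intro set_eqI iffI)
  fix z assume "z \<in> abstr srt act' N (h x)"
  then obtain \<pi> where \<pi>: "\<pi> \<in> perms srt" "z = (\<pi> ` N, act' \<pi> (h x))"
      "\<forall>a\<in>supp srt act' (h x) - N. \<pi> a = a"
    by (cases z) (auto simp: mem_abstr)
  then have "(\<pi> ` N, act \<pi> x) \<in> abstr srt act N x"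
    using assms by (auto simp: mem_abstr)
  moreover have "z = map_prod id h (\<pi> ` N, act \<pi> x)"
    using \<pi> assms by simp
  ultimately show "z \<in> map_prod id h ` abstr srt act N x" by blast
next
  fix z assume "z \<in> map_prod id h ` abstr srt act N x"
  then show "z \<in> abstr srt act' N (h x)"
    using assms by (fastforce simp: mem_abstr)
qed


subsection \<open>Conjunctions and modalities\<close>

lemma members_ex:
  assumes "|X| \<le>o |UNIV :: 'k set|"
  shows "\<exists>f :: 'k \<Rightarrow> 'x option. members f = X"
proof -
  obtain g :: "'x \<Rightarrow> 'k" where g: "inj_on g X"
    using assms unfolding card_of_ordLeq[symmetric] by blast
  let ?f = "\<lambda>k. if k \<in> g ` X then Some (inv_into X g k) else None"
  have "members ?f = X"
  proof
    show "members ?f \<subseteq> X"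
      by (auto simp: members_def inv_into_into)
    show "X \<subseteq> members ?f"
    proof
      fix x assume "x \<in> X"
      then have "?f (g x) = Some x" by (simp add: inv_into_f_f[OF g])
      then show "x \<in> members ?f" unfolding members_def by blast
    qed
  qed
  then show ?thesis by blast
qed

lemma members_map: "members (map_option h \<circ> f) = h ` members f"
  by (auto simp: members_def)

lemma Conj_members:
  fixes X :: "('n, 'k, 'p, 'a) tree set"
  assumes "|X| \<le>o |UNIV :: 'k set|"
  obtains f where "Conj X = Fam f" "members f = X"
  using someI_ex[OF members_ex[OF assms]] unfolding Conj_def by blast

lemma Conj_inject:
  fixes X Y :: "('n, 'k, 'p, 'a) tree set"
  assumes "|X| \<le>o |UNIV :: 'k set|" "|Y| \<le>o |UNIV :: 'k set|"
  shows "Conj X = Conj Y \<longleftrightarrow> X = Y"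
  by (metis Conj_members assms tree.inject(1))

lemma tree_act_Conj:
  fixes X :: "('n, 'k, 'p, 'a) tree set"
  assumes "|X| \<le>o |UNIV :: 'k set|"
  shows "tree_act T \<pi> (Conj X) = Conj (tree_act T \<pi> ` X)"
  by (rule Conj_members[OF assms]) (simp add: members_map)

lemma sat_Conj:
  fixes X :: "('n, 'k, 'p, 'a) tree set"
  assumes "|X| \<le>o |UNIV :: 'k set|"
  shows "satisfies srt T P (Conj X) \<longleftrightarrow> (\<forall>A\<in>X. satisfies srt T P A)"
  by (rule Conj_members[OF assms]) (simp add: members_map)

lemma S_fm_Conj:
  fixes X :: "('n, 'k, 'p, 'a) tree set"
  assumes "|X| \<le>o |UNIV :: 'k set|"
  shows "S_fm srt T (Conj X) = Conj (S_fm srt T ` X)"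
  by (rule Conj_members[OF assms]) (simp add: members_map)

lemma cimage_acset: "countable K \<Longrightarrow> cimage h (acset K) = acset (h ` K)"
  by (metis acset_inverse cimage.rep_eq countable_image mem_Collect_eq rcset_inverse)

lemma small_le:
  assumes "Card_order (\<kappa> :: 'k rel)" "|X| <o \<kappa>"
  shows "|X| \<le>o |UNIV :: 'k set|"
proof -
  have "|X| <o |Field \<kappa>|"
    using assms card_of_Field_ordIso ordIso_symmetric ordLess_ordIso_trans by blast
  then show ?thesis
    using card_of_mono1[of "Field \<kappa>" UNIV] ordLess_imp_ordLeq ordLeq_transitive by blast
qed

lemma small_image: "|X| <o \<kappa> \<Longrightarrow> |h ` X| <o \<kappa>"
  using card_of_image ordLeq_ordLess_trans by blast

lemma small_empty:
  assumes "natLeq <o \<kappa>" shows "|{}| <o \<kappa>"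
  by (rule ordLeq_ordLess_trans[OF _ assms])
     (metis card_of_empty1 natLeq_Card_order)

subsection \<open>Formulas form a nominal set\<close>

lemma nts_nominal:
  assumes "is_nts srt T"
  shows "nominal_set srt (state_act T) (states T)" "nominal_set srt (pred_act T) (preds T)"
    "nominal_set srt (act_act T) (acts T)"
  using assms by (auto simp: is_nts_def)

lemma bn_act:
  assumes "is_nts srt T" "\<pi> \<in> perms srt" "\<alpha> \<in> acts T"
  shows "bn T (act_act T \<pi> \<alpha>) = \<pi> ` bn T \<alpha>"
  using assms by (simp add: is_nts_def name_set_act_def)

lemma bn_supp:
  assumes "is_nts srt T" "\<alpha> \<in> acts T"
  shows "finite (bn T \<alpha>)" "bn T \<alpha> \<subseteq> supp srt (act_act T) \<alpha>"
  using assms by (simp_all add: is_nts_def)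

context
  fixes srt :: "'n \<Rightarrow> 's" and T :: "('n, 'st, 'p, 'a) nts" and \<kappa> :: "'k rel"
  assumes names: "name_sorting srt" and nts: "is_nts srt T"
    and card: "Card_order \<kappa>" and unc: "natLeq <o \<kappa>"
begin

private abbreviation (input) "form \<equiv> formulas srt T \<kappa>"
private abbreviation (input) "pact \<equiv> prod_act (act_act T) (tree_act T :: ('n, ('n, 'k, 'p, 'a) tree) action)"
private abbreviation (input) "cls \<alpha> A \<equiv> abstr srt pact (bn T \<alpha>) (\<alpha>, A)"

lemma countable_cls: "countable (abstr srt act N x)"
  by (rule countable_abstr) (use names in \<open>simp add: name_sorting_def\<close>)

lemma rcset_cls: "rcset (acset (abstr srt act N x)) = abstr srt act N x"
  by (simp add: countable_cls)

lemma small: "|X| <o \<kappa> \<Longrightarrow> |X| \<le>o |UNIV :: 'k set|"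
  by (rule small_le[OF card])

lemma tree_act_Mod_acset:
  "countable K \<Longrightarrow> tree_act T \<pi> (Mod (acset K)) =
     Mod (acset (map_prod (name_set_act \<pi>) (pact \<pi>) ` K))"
  by (simp add: cimage_acset prod_act_def)

lemma form_acts_on: "A \<in> form \<Longrightarrow> acts_on srt (tree_act T) A"
proof (induction rule: formulas.induct)
  case (Conj X)
  have X: "|X| \<le>o |UNIV :: 'k set|" by (rule small) fact
  have X': "|tree_act T \<rho> ` X| \<le>o |UNIV :: 'k set|" for \<rho>
    by (rule small[OF small_image]) fact
  have "acts_on srt (set_act (tree_act T)) X"
    by (rule acts_on_set) (use Conj in blast)
  then show ?case
    unfolding acts_on_def set_act_def by (simp add: tree_act_Conj[OF X] tree_act_Conj[OF X'])
next
  case (Neg A)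
  then show ?case by (simp add: acts_on_def)
next
  case (Pred \<phi>)
  then show ?case
    using nominal_acts_on[OF nts_nominal(2)[OF nts]] by (simp add: acts_on_def)
next
  case (Dia \<alpha> A)
  have p: "acts_on srt pact (\<alpha>, A)"
    by (rule acts_on_prod[OF nominal_acts_on[OF nts_nominal(3)[OF nts]]]) fact+
  have "acts_on srt (prod_act name_set_act pact) z" if "z \<in> cls \<alpha> A" for z
    using that p by (cases z) (auto simp: mem_abstr intro!: acts_on_prod[OF acts_on_name_set] acts_on_act)
  then have "acts_on srt (set_act (prod_act name_set_act pact)) (cls \<alpha> A)"
    by (rule acts_on_set)
  then show ?case
    unfolding acts_on_def Dia_def
    by (simp only: tree_act_Mod_acset countable_cls countable_image)
       (simp add: set_act_def prod_act_def)
qed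

lemma pact_acts_on: "\<alpha> \<in> acts T \<Longrightarrow> A \<in> form \<Longrightarrow> acts_on srt pact (\<alpha>, A)"
  by (rule acts_on_prod[OF nominal_acts_on[OF nts_nominal(3)[OF nts]] form_acts_on])

lemma tree_act_Dia:
  assumes "\<alpha> \<in> acts T" "A \<in> form" "\<pi> \<in> perms srt"
  shows "tree_act T \<pi> (Dia srt T \<alpha> A) = Dia srt T (act_act T \<pi> \<alpha>) (tree_act T \<pi> A)"
  using act_abstr[OF pact_acts_on[OF assms(1,2)] assms(3), of "bn T \<alpha>"]
  by (simp only: Dia_def tree_act_Mod_acset countable_cls)
     (simp add: bn_act[OF nts assms(3,1)] prod_act_def)

lemma form_act: "A \<in> form \<Longrightarrow> \<pi> \<in> perms srt \<Longrightarrow> tree_act T \<pi> A \<in> form"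
proof (induction arbitrary: \<pi> rule: formulas.induct)
  case (Conj X)
  have "finitely_supported srt (set_act (tree_act T)) (set_act (tree_act T) \<pi> X)"
    by (rule fs_act[OF acts_on_set]) (use Conj in \<open>auto intro: form_acts_on\<close>)
  moreover have "|tree_act T \<pi> ` X| <o \<kappa>"
    by (rule small_image) fact
  ultimately show ?case
    using Conj by (auto simp: tree_act_Conj[OF small] set_act_def intro!: formulas.Conj)
next
  case (Neg A)
  then show ?case by (simp add: formulas.Neg)
next
  case (Pred \<phi>)
  then show ?case using nominal_act[OF nts_nominal(2)[OF nts]] by (simp add: formulas.Pred)
next
  case (Dia \<alpha> A)
  then show ?case
    using nominal_act[OF nts_nominal(3)[OF nts]] by (simp add: tree_act_Dia formulas.Dia)
qed

lemma form_fs: "A \<in> form \<Longrightarrow> finitely_supported srt (tree_act T) A"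
proof (induction rule: formulas.induct)
  case (Conj X)
  then show ?case
    by (auto simp: finitely_supported_def supports_def tree_act_Conj[OF small] set_act_def)
next
  case (Neg A)
  then show ?case by (simp add: finitely_supported_def supports_def)
next
  case (Pred \<phi>)
  then show ?case
    using nominal_fs[OF nts_nominal(2)[OF nts]] by (simp add: finitely_supported_def supports_def)
next
  case (Dia \<alpha> A)
  obtain N M where "finite N" "supports srt (act_act T) N \<alpha>" "finite M" "supports srt (tree_act T) M A"
    using nominal_fs[OF nts_nominal(3)[OF nts] Dia(1)] Dia(3) by (auto simp: finitely_supported_def)
  then show ?case
    unfolding finitely_supported_def using tree_act_Dia[OF Dia(1,2)]
    by (intro exI[of _ "N \<union> M"]) (simp add: supports_def)
qed

theorem nominal_formulas: "nominal_set srt (tree_act T) form"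
  using form_act form_fs form_acts_on by (simp add: nominal_set_def acts_on_def)

lemma mem_cls:
  assumes "(N, \<beta>, B) \<in> cls \<alpha> A" "\<alpha> \<in> acts T" "A \<in> form"
  obtains \<pi> where "\<pi> \<in> perms srt" "N = bn T \<beta>" "\<beta> = act_act T \<pi> \<alpha>" "B = tree_act T \<pi> A"
    "\<beta> \<in> acts T" "B \<in> form"
proof -
  obtain \<pi> where \<pi>: "\<pi> \<in> perms srt" "N = \<pi> ` bn T \<alpha>" "(\<beta>, B) = pact \<pi> (\<alpha>, A)"
    using assms(1) by (auto simp: mem_abstr)
  then show thesis
    using that[of \<pi>] assms form_act[OF assms(3) \<pi>(1)] bn_act[OF nts \<pi>(1) assms(2)]
      nominal_act[OF nts_nominal(3)[OF nts] assms(2) \<pi>(1)]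
    by (simp add: prod_act_def)
qed

text \<open>Equality of modal formulas is \<open>\<alpha>\<close>-equivalence.\<close>

theorem Dia_eq_iff:
  assumes "\<alpha> \<in> acts T" "A \<in> form" "\<beta> \<in> acts T" "B \<in> form"
  shows "Dia srt T \<alpha> A = Dia srt T \<beta> B \<longleftrightarrow> alpha_eq srt pact (bn T \<alpha>, (\<alpha>, A)) (bn T \<beta>, (\<beta>, B))"
proof -
  have "Dia srt T \<alpha> A = Dia srt T \<beta> B \<longleftrightarrow> cls \<alpha> A = cls \<beta> B"
    unfolding Dia_def by (metis rcset_cls tree.inject(4))
  also have "\<dots> \<longleftrightarrow> (bn T \<beta>, (\<beta>, B)) \<in> cls \<alpha> A"
    using abstr_self[OF pact_acts_on[OF assms(3,4)], of "bn T \<beta>"]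
      abstr_eq[OF pact_acts_on[OF assms(1,2)], of "bn T \<beta>" "(\<beta>, B)" "bn T \<alpha>"] by auto
  finally show ?thesis by (simp add: abstr_def)
qed

theorem Conj_eq_iff:
  fixes X Y :: "('n, 'k, 'p, 'a) tree set"
  assumes "|X| <o \<kappa>" "|Y| <o \<kappa>"
  shows "Conj X = Conj Y \<longleftrightarrow> X = Y"
  by (rule Conj_inject) (use assms small in auto)

lemma sat_Dia:
  assumes "\<alpha> \<in> acts T" "A \<in> form"
  shows "satisfies srt T P (Dia srt T \<alpha> A) \<longleftrightarrow>
    (\<exists>(N, \<beta>, B) \<in> cls \<alpha> A. bn T \<beta> \<inter> supp srt (state_act T) P = {} \<and>
       (\<exists>P'. step srt T P \<beta> P' \<and> satisfies srt T P' B))"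
  unfolding Dia_def by (simp add: countable_cls case_prod_beta cimage.rep_eq)

theorem satisfies_simps:
  shows "|X| <o \<kappa> \<Longrightarrow> satisfies srt T P (Conj X) \<longleftrightarrow>
      (\<forall>A \<in> (X :: ('n, 'k, 'p, 'a) tree set). satisfies srt T P A)"
    and "satisfies srt T P (Neg A) \<longleftrightarrow> \<not> satisfies srt T P A"
    and "satisfies srt T P (Pred \<phi>) \<longleftrightarrow> (P, \<phi>) \<in> entails T"
    and "\<alpha> \<in> acts T \<Longrightarrow> A \<in> form \<Longrightarrow> satisfies srt T P (Dia srt T \<alpha> A) \<longleftrightarrow>
      (\<exists>\<beta>\<in>acts T. \<exists>B\<in>form. Dia srt T \<beta> B = Dia srt T \<alpha> A \<and>
         bn T \<beta> \<inter> supp srt (state_act T) P = {} \<and>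
         (\<exists>P'. step srt T P \<beta> P' \<and> satisfies srt T P' B))"
proof -
  show "|X| <o \<kappa> \<Longrightarrow> satisfies srt T P (Conj X) \<longleftrightarrow> (\<forall>A \<in> X. satisfies srt T P A)"
    by (rule sat_Conj[OF small])
  show "satisfies srt T P (Neg A) \<longleftrightarrow> \<not> satisfies srt T P A"
    "satisfies srt T P (Pred \<phi>) \<longleftrightarrow> (P, \<phi>) \<in> entails T"
    by simp_all
  assume A: "\<alpha> \<in> acts T" "A \<in> form"
  have "(N, \<beta>, B) \<in> cls \<alpha> A \<longleftrightarrow>
      N = bn T \<beta> \<and> \<beta> \<in> acts T \<and> B \<in> form \<and> Dia srt T \<alpha> A = Dia srt T \<beta> B" for N \<beta> B
  proof -
    have mem: "(N, \<beta>, B) \<in> cls \<alpha> A \<longleftrightarrow> alpha_eq srt pact (bn T \<alpha>, (\<alpha>, A)) (N, (\<beta>, B))"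
      by (simp add: abstr_def)
    show ?thesis
    proof
      assume *: "(N, \<beta>, B) \<in> cls \<alpha> A"
      then show "N = bn T \<beta> \<and> \<beta> \<in> acts T \<and> B \<in> form \<and> Dia srt T \<alpha> A = Dia srt T \<beta> B"
        by (rule mem_cls[OF _ A]) (use * mem Dia_eq_iff[OF A, of \<beta> B] in simp)
    qed (use mem Dia_eq_iff[OF A, of \<beta> B] in simp)
  qed
  then show "satisfies srt T P (Dia srt T \<alpha> A) \<longleftrightarrow>
      (\<exists>\<beta>\<in>acts T. \<exists>B\<in>form. Dia srt T \<beta> B = Dia srt T \<alpha> A \<and>
         bn T \<beta> \<inter> supp srt (state_act T) P = {} \<and>
         (\<exists>P'. step srt T P \<beta> P' \<and> satisfies srt T P' B))"
    unfolding sat_Dia[OF A] by (simp add: Bex_def) metis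
qed

lemma Top_form: "Top \<in> form"
  unfolding Top_def
  by (rule formulas.Conj)
     (use small_empty[OF unc] in \<open>auto simp: finitely_supported_def supports_def set_act_def\<close>)

lemma act_Top: "tree_act T \<pi> Top = (Top :: ('n, 'k, 'p, 'a) tree)"
  unfolding Top_def using tree_act_Conj[OF small[OF small_empty[OF unc]], of T \<pi>] by simp

lemma sat_Top: "satisfies srt T P (Top :: ('n, 'k, 'p, 'a) tree)"
  unfolding Top_def using sat_Conj[OF small[OF small_empty[OF unc]], of srt T P] by simp

end

subsection \<open>The translation\<close>

lemma abstr_empty:
  assumes "name_sorting srt" "acts_on srt act x" "finitely_supported srt act x"
  shows "abstr srt act {} x = {({}, x)}"
proof
  show "abstr srt act {} x \<subseteq> {({}, x)}"
    using supp_supports(2)[OF assms] by (auto simp: mem_abstr supports_def)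
  show "{({}, x)} \<subseteq> abstr srt act {} x"
    using abstr_self[OF assms(2)] by simp
qed

lemma S_nts_sel [simp]:
  "states (S_nts srt T) = states T" "state_act (S_nts srt T) = state_act T"
  "preds (S_nts srt T) = preds T" "pred_act (S_nts srt T) = pred_act T"
  "acts (S_nts srt T) = acts T <+> preds T"
  "act_act (S_nts srt T) = sum_act (act_act T) (pred_act T)"
  "entails (S_nts srt T) = {}" "bn (S_nts srt T) = case_sum (bn T) (\<lambda>_. {})"
  by (simp_all add: S_nts_def)

context
  fixes srt :: "'n \<Rightarrow> 's" and T :: "('n, 'st, 'p, 'a) nts"
  assumes names: "name_sorting srt" and nts: "is_nts srt T"
begin

private abbreviation (input) "ract \<equiv> prod_act (act_act T) (state_act T)"
private abbreviation (input) "ract' \<equiv> prod_act (sum_act (act_act T) (pred_act T)) (state_act T)"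

lemma nominal_ract: "nominal_set srt ract (acts T \<times> states T)"
  by (intro nominal_prod nts_nominal[OF nts])

lemma nominal_ract': "nominal_set srt ract' ((acts T <+> preds T) \<times> states T)"
  by (intro nominal_prod nominal_sum nts_nominal[OF nts])

lemma residual_Inl:
  "abstr srt ract' N (Inl \<alpha>, P) = map_prod id (map_prod Inl id) ` abstr srt ract N (\<alpha>, P)"
proof -
  have "supp srt ract' (Inl \<alpha>, P) = supp srt ract (\<alpha>, P)"
    by (rule supp_cong) (simp add: prod_act_def sum_act_def)
  then have "supp srt ract' (map_prod Inl id (\<alpha>, P)) = supp srt ract (\<alpha>, P)" by simp
  from abstr_image[where h = "map_prod Inl id", OF this] show ?thesis
    by (simp add: prod_act_def sum_act_def)
qed

lemma residual_Inr:
  assumes "\<phi> \<in> preds T" "P \<in> states T"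
  shows "abstr srt ract' {} (Inr \<phi>, P) = {({}, Inr \<phi>, P)}"
  by (rule abstr_empty[OF names]; rule nominal_acts_on[OF nominal_ract'] nominal_fs[OF nominal_ract'])
     (use assms in auto)

lemma entails_states: "(P, \<phi>) \<in> entails T \<Longrightarrow> P \<in> states T \<and> \<phi> \<in> preds T"
  using nts by (auto simp: is_nts_def)

lemma transitions_S:
  "transitions (S_nts srt T) =
     {(P, abstr srt ract' (bn T \<alpha>) (Inl \<alpha>, P')) | P \<alpha> P'. step srt T P \<alpha> P'} \<union>
     {(P, {({}, Inr \<phi>, P)}) | P \<phi>. (P, \<phi>) \<in> entails T}"
  unfolding S_nts_def using entails_states by (auto simp: residual_Inr) (metis residual_Inr)+

lemma inj_Inl: "inj (map_prod id (map_prod Inl id))"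
  by (intro prod.inj_map) auto

theorem step_S_Inl: "step srt (S_nts srt T) P (Inl \<alpha>) P' \<longleftrightarrow> step srt T P \<alpha> P'"
proof
  assume *: "step srt (S_nts srt T) P (Inl \<alpha>) P'"
  then have c: "P \<in> states T" "\<alpha> \<in> acts T" "P' \<in> states T"
    and "(P, abstr srt ract' (bn T \<alpha>) (Inl \<alpha>, P')) \<in> transitions (S_nts srt T)"
    by (auto simp: step_def)
  then consider \<beta> Q where "step srt T P \<beta> Q"
      "abstr srt ract' (bn T \<alpha>) (Inl \<alpha>, P') = abstr srt ract' (bn T \<beta>) (Inl \<beta>, Q)"
    | \<phi> where "abstr srt ract' (bn T \<alpha>) (Inl \<alpha>, P') = {({}, Inr \<phi>, P)}"
    unfolding transitions_S by blast
  then show "step srt T P \<alpha> P'"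
  proof cases
    case 1
    then have "abstr srt ract (bn T \<alpha>) (\<alpha>, P') = abstr srt ract (bn T \<beta>) (\<beta>, Q)"
      unfolding residual_Inl by (simp only: inj_image_eq_iff[OF inj_Inl])
    then show ?thesis using 1(1) c by (simp add: step_def)
  next
    case 2
    have "(bn T \<alpha>, Inl \<alpha>, P') \<in> abstr srt ract' (bn T \<alpha>) (Inl \<alpha>, P')"
      by (rule abstr_self[OF nominal_acts_on[OF nominal_ract']]) (use c in auto)
    then show ?thesis unfolding 2 by simp
  qed
next
  assume "step srt T P \<alpha> P'"
  then show "step srt (S_nts srt T) P (Inl \<alpha>) P'"
    unfolding step_def[of srt "S_nts srt T"] transitions_S by (auto simp: step_def)
qed

theorem step_S_Inr: "step srt (S_nts srt T) P (Inr \<phi>) P' \<longleftrightarrow> P' = P \<and> (P, \<phi>) \<in> entails T"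
proof
  assume *: "step srt (S_nts srt T) P (Inr \<phi>) P'"
  then have c: "P \<in> states T" "\<phi> \<in> preds T" "P' \<in> states T"
    and "(P, {({}, Inr \<phi>, P')}) \<in> transitions (S_nts srt T)"
    by (auto simp: step_def residual_Inr)
  then consider \<beta> Q where "{({}, Inr \<phi>, P')} = abstr srt ract' (bn T \<beta>) (Inl \<beta>, Q)"
    | \<psi> where "(P, \<psi>) \<in> entails T" "\<psi> = \<phi>" "P' = P"
    unfolding transitions_S by auto
  then show "P' = P \<and> (P, \<phi>) \<in> entails T"
  proof cases
    case 1
    then have "({}, Inr \<phi>, P') \<in> abstr srt ract' (bn T \<beta>) (Inl \<beta>, Q)" by blast
    then show ?thesis unfolding residual_Inl by auto
  next
    case 2
    then show ?thesis by auto
  qed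
next
  assume *: "P' = P \<and> (P, \<phi>) \<in> entails T"
  then show "step srt (S_nts srt T) P (Inr \<phi>) P'"
    using entails_states[of P \<phi>] unfolding step_def transitions_S
    by (auto simp: residual_Inr)
qed

lemma step_act:
  assumes "step srt T P \<alpha> P'" "\<pi> \<in> perms srt"
  shows "step srt T (state_act T \<pi> P) (act_act T \<pi> \<alpha>) (state_act T \<pi> P')"
proof -
  have c: "P \<in> states T" "\<alpha> \<in> acts T" "P' \<in> states T"
    "(P, abstr srt ract (bn T \<alpha>) (\<alpha>, P')) \<in> transitions T"
    using assms by (auto simp: step_def)
  have "(state_act T \<pi> P, set_act (prod_act name_set_act ract) \<pi> (abstr srt ract (bn T \<alpha>) (\<alpha>, P')))
      \<in> transitions T"
    using nts c(4) assms(2) unfolding is_nts_def by blast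
  also have "set_act (prod_act name_set_act ract) \<pi> (abstr srt ract (bn T \<alpha>) (\<alpha>, P')) =
      abstr srt ract (\<pi> ` bn T \<alpha>) (ract \<pi> (\<alpha>, P'))"
    using act_abstr[OF nominal_acts_on[OF nominal_ract] assms(2), of "(\<alpha>, P')" "bn T \<alpha>"] c
    by (simp add: set_act_def prod_act_def[of name_set_act])
  finally show ?thesis
    using c assms(2) nominal_act[OF nts_nominal(1)[OF nts]] nominal_act[OF nts_nominal(3)[OF nts]]
    by (simp add: step_def bn_act[OF nts] prod_act_def[of "act_act T"])
qed

theorem is_nts_S: "is_nts srt (S_nts srt T)"
  unfolding is_nts_def
proof (intro conjI)
  show "nominal_set srt (state_act (S_nts srt T)) (states (S_nts srt T))"
    "nominal_set srt (pred_act (S_nts srt T)) (preds (S_nts srt T))"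
    "nominal_set srt (act_act (S_nts srt T)) (acts (S_nts srt T))"
    using nts_nominal[OF nts] by (simp_all add: nominal_sum)
  show "entails (S_nts srt T) \<subseteq> states (S_nts srt T) \<times> preds (S_nts srt T)"
    "\<forall>\<pi>\<in>perms srt. \<forall>(P, \<phi>)\<in>entails (S_nts srt T).
       (state_act (S_nts srt T) \<pi> P, pred_act (S_nts srt T) \<pi> \<phi>) \<in> entails (S_nts srt T)"
    by simp_all
  have "supp srt (sum_act (act_act T) (pred_act T)) (Inl \<alpha>) = supp srt (act_act T) \<alpha>" for \<alpha>
    by (rule supp_cong) (simp add: sum_act_def)
  then show "\<forall>\<alpha>\<in>acts (S_nts srt T). finite (bn (S_nts srt T) \<alpha>) \<and>
      bn (S_nts srt T) \<alpha> \<subseteq> supp srt (act_act (S_nts srt T)) \<alpha>"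
    by (auto simp: bn_supp(1)[OF nts] dest: subsetD[OF bn_supp(2)[OF nts]])
  show "\<forall>\<pi>\<in>perms srt. \<forall>\<alpha>\<in>acts (S_nts srt T).
      bn (S_nts srt T) (act_act (S_nts srt T) \<pi> \<alpha>) = name_set_act \<pi> (bn (S_nts srt T) \<alpha>)"
    using bn_act[OF nts] by (auto simp: sum_act_def name_set_act_def)
  show "transitions (S_nts srt T) \<subseteq> states (S_nts srt T) \<times>
      {residual srt (S_nts srt T) N \<alpha> Q | N \<alpha> Q.
         finite N \<and> \<alpha> \<in> acts (S_nts srt T) \<and> Q \<in> states (S_nts srt T)}"
  proof (rule subrelI)
    fix P C assume "(P, C) \<in> transitions (S_nts srt T)"
    then consider \<alpha> P' where "step srt T P \<alpha> P'" "C = abstr srt ract' (bn T \<alpha>) (Inl \<alpha>, P')"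
      | \<phi> where "(P, \<phi>) \<in> entails T" "C = {({}, Inr \<phi>, P)}"
      unfolding transitions_S by blast
    then show "(P, C) \<in> states (S_nts srt T) \<times>
      {residual srt (S_nts srt T) N \<alpha> Q | N \<alpha> Q.
         finite N \<and> \<alpha> \<in> acts (S_nts srt T) \<and> Q \<in> states (S_nts srt T)}"
    proof cases
      case 1
      then have "P \<in> states T" "finite (bn T \<alpha>)" "\<alpha> \<in> acts T" "P' \<in> states T"
        using bn_supp[OF nts] by (auto simp: step_def)
      then show ?thesis unfolding 1(2) by auto
    next
      case 2
      then have "P \<in> states T" "\<phi> \<in> preds T" using entails_states by auto
      moreover from this have "C = residual srt (S_nts srt T) {} (Inr \<phi>) P"
        using 2 by (simp add: residual_Inr)
      ultimately show ?thesis by auto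
    qed
  qed
  show "\<forall>\<pi>\<in>perms srt. \<forall>(P, C)\<in>transitions (S_nts srt T).
      (state_act (S_nts srt T) \<pi> P,
       set_act (prod_act name_set_act (prod_act (act_act (S_nts srt T)) (state_act (S_nts srt T)))) \<pi> C)
        \<in> transitions (S_nts srt T)"
  proof (intro ballI, clarify)
    fix \<pi> P C assume \<pi>: "\<pi> \<in> perms srt" and "(P, C) \<in> transitions (S_nts srt T)"
    then consider \<alpha> P' where "step srt T P \<alpha> P'" "C = abstr srt ract' (bn T \<alpha>) (Inl \<alpha>, P')"
      | \<phi> where "(P, \<phi>) \<in> entails T" "C = {({}, Inr \<phi>, P)}"
      unfolding transitions_S by blast
    then show "(state_act (S_nts srt T) \<pi> P,
       set_act (prod_act name_set_act (prod_act (act_act (S_nts srt T)) (state_act (S_nts srt T)))) \<pi> C)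
        \<in> transitions (S_nts srt T)"
    proof cases
      case 1
      then have c: "\<alpha> \<in> acts T" "P' \<in> states T" by (auto simp: step_def)
      have "set_act (prod_act name_set_act ract') \<pi> C = abstr srt ract' (\<pi> ` bn T \<alpha>) (ract' \<pi> (Inl \<alpha>, P'))"
        using act_abstr[OF nominal_acts_on[OF nominal_ract'] \<pi>, of "(Inl \<alpha>, P')" "bn T \<alpha>"] c 1(2)
        by (simp add: set_act_def prod_act_def[of name_set_act] InlI)
      also have "\<dots> = abstr srt ract' (bn T (act_act T \<pi> \<alpha>)) (Inl (act_act T \<pi> \<alpha>), state_act T \<pi> P')"
        by (simp add: bn_act[OF nts \<pi> c(1)]) (simp add: prod_act_def sum_act_def)
      finally show ?thesis
        using step_act[OF 1(1) \<pi>] unfolding transitions_S by auto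
    next
      case 2
      have "(state_act T \<pi> P, pred_act T \<pi> \<phi>) \<in> entails T"
        using nts \<pi> 2(1) by (auto simp: is_nts_def)
      moreover have "set_act (prod_act name_set_act ract') \<pi> C = {({}, Inr (pred_act T \<pi> \<phi>), state_act T \<pi> P)}"
        unfolding 2(2) by (simp add: set_act_def prod_act_def sum_act_def name_set_act_def)
      ultimately show ?thesis unfolding transitions_S by auto
    qed
  qed
  show "\<forall>P\<in>states (S_nts srt T). \<forall>\<alpha>\<in>acts (S_nts srt T). \<forall>Q\<in>states (S_nts srt T). \<forall>N.
      finite N \<longrightarrow> (P, residual srt (S_nts srt T) N \<alpha> Q) \<in> transitions (S_nts srt T) \<longrightarrow>
      N = bn (S_nts srt T) \<alpha>"
  proof (intro ballI allI impI)
    fix P \<alpha> Q N assume P: "P \<in> states (S_nts srt T)" and \<alpha>: "\<alpha> \<in> acts (S_nts srt T)"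
      and Q: "Q \<in> states (S_nts srt T)"
      and tr: "(P, residual srt (S_nts srt T) N \<alpha> Q) \<in> transitions (S_nts srt T)"
    have self: "(N, \<alpha>, Q) \<in> abstr srt ract' N (\<alpha>, Q)"
      by (rule abstr_self[OF nominal_acts_on[OF nominal_ract']]) (use \<alpha> Q in auto)
    from tr consider \<beta> P' where "step srt T P \<beta> P'"
        "abstr srt ract' N (\<alpha>, Q) = abstr srt ract' (bn T \<beta>) (Inl \<beta>, P')"
      | \<phi> where "abstr srt ract' N (\<alpha>, Q) = {({}, Inr \<phi>, P)}"
      unfolding transitions_S by auto
    then show "N = bn (S_nts srt T) \<alpha>"
    proof cases
      case 1
      then have "\<beta> \<in> acts T" by (simp add: step_def)
      obtain \<pi> where "\<pi> \<in> perms srt" "N = \<pi> ` bn T \<beta>" "\<alpha> = Inl (act_act T \<pi> \<beta>)"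
        using self unfolding 1(2) by (auto simp: mem_abstr prod_act_def sum_act_def)
      then show ?thesis using bn_act[OF nts _ \<open>\<beta> \<in> acts T\<close>] by simp
    next
      case 2
      then show ?thesis using self by auto
    qed
  qed
qed

end

context
  fixes srt :: "'n \<Rightarrow> 's" and T :: "('n, 'st, 'p, 'a) nts" and \<kappa> :: "'k rel"
  assumes names: "name_sorting srt" and nts: "is_nts srt T"
    and card: "Card_order \<kappa>" and unc: "natLeq <o \<kappa>"
begin

private abbreviation (input) "formS \<equiv> formulas srt T \<kappa>"
private abbreviation (input) "pactS \<equiv> prod_act (act_act T) (tree_act T :: ('n, ('n, 'k, 'p, 'a) tree) action)"
private abbreviation (input) "clsS \<alpha> A \<equiv> abstr srt pactS (bn T \<alpha>) (\<alpha>, A)"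
private abbreviation (input) "T' \<equiv> S_nts srt T"
private abbreviation (input) "pact' \<equiv>
  prod_act (act_act T') (tree_act T' :: ('n, ('n, 'k, 'p, 'a + 'p) tree) action)"
private abbreviation (input) "\<S> \<equiv> (S_fm srt T :: ('n, 'k, 'p, 'a) tree \<Rightarrow> _)"
private abbreviation (input) "\<J> \<equiv> map_prod (id :: 'n set \<Rightarrow> _) (map_prod (Inl :: 'a \<Rightarrow> 'a + 'p) \<S>)"

lemma nts': "is_nts srt T'"
  by (rule is_nts_S[OF names nts])

lemma S_fm_Mod_cls: "\<S> (Dia srt T \<alpha> A) = Mod (acset (\<J> ` clsS \<alpha> A))"
  unfolding Dia_def by (simp add: cimage_acset countable_cls[OF names nts card unc])

lemma S_fm_Pred:
  assumes "\<phi> \<in> preds T"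
  shows "\<S> (Pred \<phi>) = Mod (acset {({}, Inr \<phi>, Top)})"
proof -
  have "Top \<in> formulas srt T' \<kappa>" by (rule Top_form[OF names nts' card unc])
  then have "abstr srt pact' {} (Inr \<phi>, Top) = {({}, Inr \<phi>, Top)}"
    using nominal_prod[OF nts_nominal(3)[OF nts'] nominal_formulas[OF names nts' card unc]] assms
    by (intro abstr_empty[OF names] nominal_acts_on[where X = "acts T' \<times> formulas srt T' \<kappa>"]
          nominal_fs[where X = "acts T' \<times> formulas srt T' \<kappa>"]) auto
  then show ?thesis by (simp add: Dia_def)
qed

lemma S_fm_act_orbit:
  assumes "A \<in> formS" "\<sigma> \<in> perms srt" "\<pi> \<in> perms srt"
  shows "tree_act T' \<pi> (\<S> (tree_act T \<sigma> A)) = \<S> (tree_act T \<pi> (tree_act T \<sigma> A))"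
  using assms
proof (induction arbitrary: \<sigma> \<pi> rule: formulas.induct)
  case (Conj X)
  note s = small_le[OF card small_image[OF \<open>|X| <o \<kappa>\<close>]] small_le[OF card \<open>|X| <o \<kappa>\<close>]
    small_le[OF card small_image[OF small_image[OF \<open>|X| <o \<kappa>\<close>]]]
  have "tree_act T' \<pi> ` \<S> ` tree_act T \<sigma> ` X = \<S> ` tree_act T \<pi> ` tree_act T \<sigma> ` X"
    unfolding image_image using Conj by (intro image_cong) auto
  then show ?case
    by (simp add: tree_act_Conj S_fm_Conj s)
next
  case (Neg A)
  then show ?case by simp
next
  case (Pred \<phi>)
  have "pred_act T \<sigma> \<phi> \<in> preds T"
    using Pred nominal_act[OF nts_nominal(2)[OF nts]] by blast
  moreover from this have "pred_act T \<pi> (pred_act T \<sigma> \<phi>) \<in> preds T"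
    using Pred nominal_act[OF nts_nominal(2)[OF nts]] by blast
  ultimately show ?case
    by (simp del: S_fm.simps add: S_fm_Pred)
       (simp add: cimage_acset name_set_act_def sum_act_def act_Top[OF names nts' card unc])
next
  case (Dia \<alpha> A)
  let ?\<alpha> = "act_act T \<sigma> \<alpha>" and ?A = "tree_act T \<sigma> A"
  have c: "?\<alpha> \<in> acts T" "?A \<in> formS"
    using Dia nominal_act[OF nts_nominal(3)[OF nts]] form_act[OF names nts card unc] by auto
  have eq: "tree_act T' \<pi> (\<S> B) = \<S> (tree_act T \<pi> B)" if z: "(N, \<beta>, B) \<in> clsS ?\<alpha> ?A" for N \<beta> B
  proof -
    obtain \<rho> where \<rho>: "\<rho> \<in> perms srt" "B = tree_act T \<rho> ?A"
      using mem_cls[OF names nts card unc z c] by metis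
    then have "B = tree_act T (\<rho> \<circ> \<sigma>) A"
      using acts_on_comp[OF form_acts_on[OF names nts card unc Dia.hyps(2)] \<rho>(1) Dia.prems(1)] by (simp only:)
    then show ?thesis
      using Dia.IH[OF perms_comp[OF \<rho>(1) Dia.prems(1)] Dia.prems(2)] by (simp only:)
  qed
  have "tree_act T' \<pi> (\<S> (Dia srt T ?\<alpha> ?A)) =
    Mod (acset (map_prod (name_set_act \<pi>) (map_prod (map_sum (act_act T \<pi>) (pred_act T \<pi>)) (tree_act T' \<pi>))
        ` \<J> ` clsS ?\<alpha> ?A))"
    unfolding S_fm_Mod_cls by (simp add: cimage_acset countable_cls[OF names nts card unc] sum_act_def)
  also have "map_prod (name_set_act \<pi>) (map_prod (map_sum (act_act T \<pi>) (pred_act T \<pi>)) (tree_act T' \<pi>))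
        ` \<J> ` clsS ?\<alpha> ?A =
      \<J> ` map_prod (name_set_act \<pi>) (map_prod (act_act T \<pi>) (tree_act T \<pi>)) ` clsS ?\<alpha> ?A"
    unfolding image_image using eq by (intro image_cong) auto
  also have "Mod (acset \<dots>) = \<S> (tree_act T \<pi> (Dia srt T ?\<alpha> ?A))"
    unfolding Dia_def by (simp add: cimage_acset countable_cls[OF names nts card unc])
  finally show ?case
    using Dia by (simp add: tree_act_Dia[OF names nts card unc])
qed

lemma S_fm_act:
  "A \<in> formS \<Longrightarrow> \<pi> \<in> perms srt \<Longrightarrow> tree_act T' \<pi> (\<S> A) = \<S> (tree_act T \<pi> A)"
  using S_fm_act_orbit[of A id \<pi>] acts_on_id[OF form_acts_on[OF names nts card unc]] by (simp add: perms_id)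

lemma S_fm_inj: "A \<in> formS \<Longrightarrow> B \<in> formS \<Longrightarrow> \<S> A = \<S> B \<Longrightarrow> A = B"
proof (induction arbitrary: B rule: formulas.induct)
  case (Conj X)
  have X: "\<S> (Conj X) = Conj (\<S> ` X)"
    by (rule S_fm_Conj[OF small_le[OF card]]) fact
  from Conj.prems(1) show ?case
  proof cases
    case (Conj Y)
    have "\<S> B = Conj (\<S> ` Y)"
      unfolding Conj(1) by (rule S_fm_Conj[OF small_le[OF card]]) fact
    then have "\<S> ` X = \<S> ` Y"
      using X Conj.prems(2) Conj_eq_iff[OF names nts' card unc] small_image \<open>|X| <o \<kappa>\<close> \<open>|Y| <o \<kappa>\<close> by metis
    then have "X = Y"
      using Conj.IH Conj(2) by (auto simp: set_eq_iff image_iff) metis+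
    then show ?thesis using Conj by simp
  qed (use Conj.prems(2) X S_fm_Mod_cls S_fm_Pred in \<open>auto simp: Conj_def simp del: S_fm.simps(3)\<close>)
next
  case (Neg A)
  from Neg.prems(1) show ?case
    by cases (use Neg S_fm_Conj[OF small_le[OF card]] S_fm_Mod_cls S_fm_Pred in
      \<open>auto simp: Conj_def simp del: S_fm.simps(3)\<close>)
next
  case (Pred \<phi>)
  from Pred.prems(1) show ?case
  proof cases
    case (Dia \<beta> B')
    have "{({}, Inr \<phi>, Top)} = \<J> ` clsS \<beta> B'"
      using Pred.prems(2) S_fm_Pred[OF Pred.hyps] S_fm_Mod_cls[of \<beta> B'] Dia(1)
      by (simp add: acset_inject countable_cls[OF names nts card unc] del: S_fm.simps(3))
    then have "({}, Inr \<phi>, Top) \<in> \<J> ` clsS \<beta> B'" by blast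
    then show ?thesis by auto
  next
    case (Pred \<psi>)
    then show ?thesis
      using Pred.prems(2) S_fm_Pred Pred.hyps by (simp add: acset_inject del: S_fm.simps(3))
  qed (use Pred.prems(2) Pred.hyps S_fm_Conj[OF small_le[OF card]] S_fm_Pred in
      \<open>auto simp: Conj_def simp del: S_fm.simps(3)\<close>)
next
  case (Dia \<alpha> A)
  from Dia.prems(1) show ?case
  proof cases
    case (Pred \<phi>)
    have "{({}, Inr \<phi>, Top)} = \<J> ` clsS \<alpha> A"
      using Dia.prems(2) S_fm_Pred[OF Pred(2)] S_fm_Mod_cls[of \<alpha> A] Pred(1)
      by (simp add: acset_inject countable_cls[OF names nts card unc] del: S_fm.simps(3))
    then have "({}, Inr \<phi>, Top) \<in> \<J> ` clsS \<alpha> A" by blast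
    then show ?thesis by auto
  next
    case (Dia \<beta> B')
    have eq: "\<J> ` clsS \<alpha> A = \<J> ` clsS \<beta> B'"
      using Dia.prems(2) S_fm_Mod_cls[of \<alpha> A] S_fm_Mod_cls[of \<beta> B'] Dia(1)
      by (simp add: acset_inject countable_cls[OF names nts card unc])
    have "(bn T \<alpha>, \<alpha>, A) \<in> clsS \<alpha> A"
      by (rule abstr_self[OF pact_acts_on[OF names nts card unc]]) fact+
    then have "\<J> (bn T \<alpha>, \<alpha>, A) \<in> \<J> ` clsS \<beta> B'"
      using eq by blast
    then obtain B'' where B'': "(bn T \<alpha>, \<alpha>, B'') \<in> clsS \<beta> B'" "\<S> A = \<S> B''"
      by auto
    have "B'' \<in> formS" using mem_cls[OF names nts card unc B''(1) Dia(2,3)] by metis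
    then have "A = B''" using Dia.IH B''(2) by blast
    then have "clsS \<alpha> A = clsS \<beta> B'"
      using abstr_eq[OF pact_acts_on[OF names nts card unc Dia(2,3)]] B''(1) by simp
    then show ?thesis using Dia(1) by (simp add: Dia_def)
  qed (use Dia.prems(2) S_fm_Conj[OF small_le[OF card]] S_fm_Mod_cls in \<open>auto simp: Conj_def\<close>)
qed

theorem S_fm_Dia:
  assumes "\<alpha> \<in> acts T" "A \<in> formS"
  shows "\<S> (Dia srt T \<alpha> A) = Dia srt T' (Inl \<alpha>) (\<S> A)"
proof -
  have act: "pact' \<pi> (map_prod Inl \<S> (\<alpha>, A)) = map_prod Inl \<S> (pactS \<pi> (\<alpha>, A))" if "\<pi> \<in> perms srt" for \<pi>
    using S_fm_act[OF assms(2) that] by (simp add: prod_act_def sum_act_def)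
  have supp: "supp srt pact' (map_prod Inl \<S> (\<alpha>, A)) = supp srt pactS (\<alpha>, A)"
  proof (rule supp_cong)
    fix \<pi> assume \<pi>: "\<pi> \<in> perms srt"
    have "\<S> (tree_act T \<pi> A) = \<S> A \<longleftrightarrow> tree_act T \<pi> A = A"
      using S_fm_inj[OF form_act[OF names nts card unc assms(2) \<pi>] assms(2)] by auto
    then show "pact' \<pi> (map_prod Inl \<S> (\<alpha>, A)) = map_prod Inl \<S> (\<alpha>, A) \<longleftrightarrow> pactS \<pi> (\<alpha>, A) = (\<alpha>, A)"
      unfolding act[OF \<pi>] by (simp add: prod_act_def)
  qed
  show ?thesis
    using abstr_image[OF supp act, of "bn T \<alpha>"]
    unfolding S_fm_Mod_cls unfolding Dia_def by simp
qed

theorem S_fm_eqs: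
  shows "|X| <o \<kappa> \<Longrightarrow> \<S> (Conj X) = Conj (\<S> ` X)"
    and "\<S> (Neg A) = Neg (\<S> A)"
    and "\<S> (Pred \<phi>) = Dia srt T' (Inr \<phi>) Top"
    and "\<alpha> \<in> acts T \<Longrightarrow> A \<in> formS \<Longrightarrow> \<S> (Dia srt T \<alpha> A) = Dia srt T' (Inl \<alpha>) (\<S> A)"
  using S_fm_Conj[OF small_le[OF card]] S_fm_Dia by simp_all

theorem S_fm_form: "A \<in> formS \<Longrightarrow> \<S> A \<in> formulas srt T' \<kappa>"
proof (induction rule: formulas.induct)
  case (Conj X)
  have "finitely_supported srt (set_act (tree_act T')) (\<S> ` X)"
  proof -
    obtain N where N: "finite N" "supports srt (set_act (tree_act T)) N X"
      using Conj by (auto simp: finitely_supported_def)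
    have "tree_act T' \<pi> ` \<S> ` X = \<S> ` tree_act T \<pi> ` X" if "\<pi> \<in> perms srt" for \<pi>
      unfolding image_image using S_fm_act[OF _ that] Conj by (intro image_cong) auto
    then show ?thesis
      using N unfolding finitely_supported_def supports_def set_act_def
      by (intro exI[of _ N]) simp
  qed
  then show ?case
    using Conj small_image by (auto simp: S_fm_eqs(1) intro!: formulas.Conj)
next
  case (Neg A)
  then show ?case by (simp add: formulas.Neg)
next
  case (Pred \<phi>)
  then show ?case
    by (auto intro!: formulas.Dia Top_form[OF names nts' card unc])
next
  case (Dia \<alpha> A)
  then show ?case
    by (auto simp: S_fm_Dia intro!: formulas.Dia)
qed

end

end

theory Submission
  imports Defs
begin

text \<open>
  Induction on the formula. A modality \<open>\<langle>\<alpha>\<rangle>A\<close> is evaluated at a representative \<open>\<langle>\<rho> \<cdot> \<alpha>\<rangle>(\<rho> \<cdot> A)\<close> whose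
  bound names are fresh for the state, so the induction hypothesis is needed for all permuted
  variants of \<open>A\<close>; the claim is therefore proved for the whole orbit of a formula at once.
\<close>

text \<open>As \<open>Inr \<phi>\<close> binds nothing, the translated modality has one
  representative and freshness is vacuous. The only possible \<open>Inr \<phi>\<close>-step is a
  loop at \<open>P\<close>, present iff \<open>P\<close> entails \<open>\<phi>\<close>, and
  \<open>Top\<close> holds at its target.\<close>

lemma sat_S_fm_Pred:
  fixes srt :: "'n \<Rightarrow> 's" and T :: "('n, 'st, 'p, 'a) nts" and \<kappa> :: "'k rel"
  assumes "name_sorting srt" "is_nts srt T" "Card_order \<kappa>" "natLeq <o \<kappa>" "\<phi> \<in> preds T"
  shows "satisfies srt (S_nts srt T) P (S_fm srt T (Pred \<phi> :: ('n, 'k, 'p, 'a) tree)) \<longleftrightarrow>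
    (P, \<phi>) \<in> entails T"
  unfolding S_fm_Pred[OF assms]
  using sat_Top[OF assms(1) is_nts_S[OF assms(1,2)] assms(3,4)]
  by (simp add: cimage.rep_eq step_S_Inr[OF assms(1,2)])

lemma sat_S_fm_orbit:
  fixes srt :: "'n \<Rightarrow> 's" and T :: "('n, 'st, 'p, 'a) nts" and \<kappa> :: "'k rel"
    and A :: "('n, 'k, 'p, 'a) tree"
  assumes wf: "name_sorting srt" "is_nts srt T" "Card_order \<kappa>" "natLeq <o \<kappa>"
    and "A \<in> formulas srt T \<kappa>" "\<sigma> \<in> perms srt"
  shows "satisfies srt (S_nts srt T) P (S_fm srt T (tree_act T \<sigma> A)) \<longleftrightarrow>
    satisfies srt T P (tree_act T \<sigma> A)"
  using assms(5,6)
proof (induction arbitrary: \<sigma> P rule: formulas.induct)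
  case (Conj X)
  \<comment> \<open>\<open>Conj\<close> behaves as set conjunction only on sets that can be
    enumerated by \<open>'k\<close>; images of \<open>X\<close> stay below
    \<open>\<kappa>\<close>.\<close>
  note small = small_le[OF wf(3)] small_image \<open>|X| <o \<kappa>\<close>
  show ?case
    using Conj by (simp add: tree_act_Conj S_fm_Conj sat_Conj small)
next
  case (Neg A)
  then show ?case by simp
next
  case (Pred \<phi>)
  then have "pred_act T \<sigma> \<phi> \<in> preds T"
    using nominal_act[OF nts_nominal(2)[OF wf(2)]] by blast
  then show ?case
    using sat_S_fm_Pred[OF wf] by (simp del: S_fm.simps)
next
  case (Dia \<alpha> A)
  let ?\<alpha> = "act_act T \<sigma> \<alpha>" and ?A = "tree_act T \<sigma> A"
  let ?C = "abstr srt (prod_act (act_act T) (tree_act T)) (bn T ?\<alpha>) (?\<alpha>, ?A)"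
  have c: "?\<alpha> \<in> acts T" "?A \<in> formulas srt T \<kappa>"
    using Dia nominal_act[OF nts_nominal(3)[OF wf(2)]] form_act[OF wf] by auto
  \<comment> \<open>Every representative lies in the orbit of \<open>A\<close>: the hypothesis is
    used at \<open>\<rho> \<circ> \<sigma>\<close>.\<close>
  have IH: "satisfies srt (S_nts srt T) Q (S_fm srt T B) \<longleftrightarrow> satisfies srt T Q B"
    if z: "(N, \<beta>, B) \<in> ?C" for N \<beta> B Q
  proof -
    obtain \<rho> where \<rho>: "\<rho> \<in> perms srt" "B = tree_act T \<rho> ?A"
      using mem_cls[OF wf z c] by metis
    then have "B = tree_act T (\<rho> \<circ> \<sigma>) A"
      using acts_on_comp[OF form_acts_on[OF wf Dia.hyps(2)] \<rho>(1) Dia.prems] by (simp only:)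
    then show ?thesis
      using Dia.IH[OF perms_comp[OF \<rho>(1) Dia.prems]] by (simp only:)
  qed
  \<comment> \<open>The translation works representative by representative and keeps binders, state
    supports and steps, so both sides range over the same class \<open>?C\<close>.\<close>
  have "satisfies srt (S_nts srt T) P (S_fm srt T (Dia srt T ?\<alpha> ?A)) \<longleftrightarrow>
    (\<exists>(N, \<beta>, B) \<in> ?C. bn T \<beta> \<inter> supp srt (state_act T) P = {} \<and>
       (\<exists>P'. step srt T P \<beta> P' \<and> satisfies srt (S_nts srt T) P' (S_fm srt T B)))"
    unfolding S_fm_Mod_cls[OF wf]
    by (simp add: countable_cls[OF wf] cimage.rep_eq case_prod_beta step_S_Inl[OF wf(1,2)])
  also have "\<dots> \<longleftrightarrow> satisfies srt T P (Dia srt T ?\<alpha> ?A)"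
    unfolding sat_Dia[OF wf c] using IH by (intro bex_cong refl) auto
  finally show ?case
    using Dia by (simp add: tree_act_Dia[OF wf])
qed

theorem theorem8p5:
  fixes srt :: "'n \<Rightarrow> 's"
    and T :: "('n, 'st, 'p, 'a) nts"
    and \<kappa> :: "'k rel"
    and A :: "('n, 'k, 'p, 'a) tree"
    and P :: 'st
  assumes "name_sorting srt"
    and "is_nts srt T"
    and "Card_order \<kappa>" and "natLeq <o \<kappa>" and "|states T| <o \<kappa>"
    and "A \<in> formulas srt T \<kappa>"
    and "P \<in> states T"
  shows "satisfies srt T P A \<longleftrightarrow> satisfies srt (S_nts srt T) P (S_fm srt T A)"
  \<comment> \<open>\<open>A\<close> is the point of its orbit given by the identity
    permutation.\<close>
  using sat_S_fm_orbit[OF assms(1-4,6) perms_id] acts_on_id[OF form_acts_on[OF assms(1-4,6)]]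
  by simp

end
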